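(* The sets $R_{-\frac12}$ and $R_{-\frac13}$ satisfy the following properties: (a) $2R_{-\frac12} \subset R_{-\frac12}$ and $2R_{-\frac13} \subset R_{-\frac13}$; (b) $R_{-\frac12} \subset 5\mathbb{N}$ and $R_{-\frac13} \subset 21\mathbb{N}$; (c) for all non-negative integers $n, k$: if $5n \in R_{-\frac12}$ and $2^k > 5n$, then $5(2^k + n) \in R_{-\frac12}$ and $5(2^k - n) \in R_{-\frac12}$; (d) for all non-negative integers $n, k$: if $21n \in R_{-\frac13}$ and $2^k > 21n$, then $21(2^k + n) \in R_{-\frac13}$ and $21(2^k - n) \in R_{-\frac13}$.
   Context: $\mathbb{N}$ denotes the set of non-negative integers. The Stern polynomials $B_n(t) \in \mathbb{Z}[t]$, $n \geq 0$, are defined by $B_0(t) = 0$, $B_1(t) = 1$, and for $n \geq 2$: $B_n(t) = t\,B_{n/2}(t)$ if $n$ is even, and $B_n(t) = B_{(n+1)/2}(t) + B_{(n-1)/2}(t)$ if $n$ is odd. For $a \in \mathbb{Q}$, $R_a = \{n \in \mathbb{N} \mid B_n(a) = 0\}$. For a set $A \subset \mathbb{N}$ and an integer $c$, $cA = \{ca \mid a \in A\}$. *)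

theory Defs
  imports "HOL-Computational_Algebra.Polynomial"
begin

function stern_poly :: "nat \<Rightarrow> int poly" where
  "stern_poly n =
     (if n = 0 then 0
      else if n = 1 then 1
      else if even n then [:0, 1:] * stern_poly (n div 2)
      else stern_poly ((n + 1) div 2) + stern_poly ((n - 1) div 2))"
  by auto

termination
proof (relation "measure id", goal_cases)
  case 1
  then show ?case by simp
next
  case (2 n)
  then show ?case by simp
next
  case (3 n)
  then show ?case by (auto elim!: oddE)
next
  case (4 n)
  then show ?case by simp
qed

declare stern_poly.simps [simp del]

definition stern_roots :: "rat \<Rightarrow> nat set" where
  "stern_roots a = {n. poly (map_poly of_int (stern_poly n)) a = 0}"

end

theory Submission
  imports Defs
begin

text \<open>
  Write \<open>B\<close> for the Stern polynomials. Part (a) is the recurrence \<open>B(2n) = t B(n)\<close>. The other parts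
  rest on two ideas.

  Divisibility (\<open>root_imp_dvd_poly\<close>): if an integer polynomial vanishes at \<open>-1/q\<close>, then
  for every integer \<open>b\<close> its value at \<open>b\<close> is divisible by \<open>q b + 1\<close>, because \<open>-1/q\<close> and \<open>b\<close> are
  congruent modulo \<open>q b + 1\<close>. Since \<open>B(n)\<close> takes the value \<open>n\<close> at \<open>2\<close>, a root \<open>-1/2\<close> forces
  \<open>5 dvd n\<close> and a root \<open>-1/3\<close> forces \<open>7 dvd n\<close>. At \<open>b = 1\<close> a root \<open>-1/3\<close> makes the value divisible
  by \<open>4\<close>; this value is a term of Stern's diatomic sequence, which is even exactly at the multiples
  of \<open>3\<close>.

  Translation (\<open>stern_value_block\<close>): between the consecutive multiples \<open>2^k m\<close> and \<open>2^k (m + 1)\<close>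
  the Stern polynomials are the combination
  \<open>B(2^k m + r) = B(2^k - r) B(m) + B(r) B(m + 1)\<close>. If \<open>B(c)\<close> and \<open>B(r)\<close> both vanish at a point, then
  taking \<open>m = c\<close>, and \<open>m = c - 1\<close> with \<open>r\<close> replaced by \<open>2^k - r\<close>, makes both terms on the right
  vanish, so that \<open>2^k c + r\<close> and \<open>2^k c - r\<close> are again indices of a zero. This applies with \<open>c = 5\<close>
  and \<open>c = 21\<close>, because \<open>B(5) = 2 t + 1\<close> and \<open>B(21) = (3 t + 1) (t + 1)\<close>.
\<close>

lemma stern_poly_0: "stern_poly 0 = 0"
  by (subst stern_poly.simps) simp

lemma stern_poly_1: "stern_poly (Suc 0) = 1"
  by (subst stern_poly.simps) simp

lemma stern_poly_double: "stern_poly (2 * n) = pCons 0 (stern_poly n)"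
proof (cases "n = 0")
  case False
  then show ?thesis by (subst stern_poly.simps) simp
qed (simp add: stern_poly_0)

lemma stern_poly_double_Suc: "stern_poly (Suc (2 * n)) = stern_poly n + stern_poly (Suc n)"
proof (cases "n = 0")
  case False
  then show ?thesis by (subst stern_poly.simps) (simp add: add.commute)
qed (simp add: stern_poly_0 stern_poly_1)

definition stern_value :: "rat \<Rightarrow> nat \<Rightarrow> rat" where
  "stern_value a n = poly (map_poly of_int (stern_poly n)) a"

lemma mem_stern_roots_iff: "n \<in> stern_roots a \<longleftrightarrow> stern_value a n = 0"
  by (simp add: stern_roots_def stern_value_def)

lemma stern_value_0: "stern_value a 0 = 0"
  by (simp add: stern_value_def stern_poly_0)

lemma stern_value_1: "stern_value a (Suc 0) = 1"
  by (simp add: stern_value_def stern_poly_1)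

lemma stern_value_double: "stern_value a (2 * n) = a * stern_value a n"
  by (simp add: stern_value_def stern_poly_double map_poly_pCons)

lemma stern_value_double_Suc:
  "stern_value a (Suc (2 * n)) = stern_value a n + stern_value a (Suc n)"
proof -
  have "map_poly of_int (p + q) = map_poly of_int p + (map_poly of_int q :: rat poly)"
    for p q :: "int poly"
    by (rule poly_eqI) (simp add: coeff_map_poly)
  then show ?thesis by (simp add: stern_value_def stern_poly_double_Suc)
qed

section \<open>Divisibility of the indices\<close>

text \<open>
  Multiplication by a power of \<open>q\<close> clears the denominators, and modulo \<open>q b + 1\<close> the integer \<open>b\<close>
  takes the place of \<open>-1/q\<close>. Leaving the exponent \<open>k\<close> existential keeps the induction on the
  coefficients free of degrees.
\<close>

lemma poly_neg_inverse_cong: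
  fixes p :: "int poly" and q b :: int
  assumes "q \<noteq> 0"
  shows "\<exists>k m. of_int (q ^ k) * poly (map_poly of_int p) (- 1 / of_int q :: rat) = of_int m \<and>
           (q * b + 1) dvd (m - q ^ k * poly p b)"
proof (induction p)
  case 0
  show ?case by (intro exI[of _ 0]) simp
next
  case (pCons c p)
  let ?x = "- 1 / of_int q :: rat"
  obtain k m where km: "of_int (q ^ k) * poly (map_poly of_int p) ?x = of_int m"
    and dvd: "(q * b + 1) dvd (m - q ^ k * poly p b)"
    using pCons.IH by blast
  have "of_int (q ^ Suc k) * poly (map_poly of_int (pCons c p)) ?x =
        of_int (q ^ Suc k * c) - of_int (q ^ k) * poly (map_poly of_int p) ?x"
    using assms by (simp add: map_poly_pCons field_simps)
  also have "\<dots> = of_int (q ^ Suc k * c - m)"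
    using km by simp
  finally have 1: "of_int (q ^ Suc k) * poly (map_poly of_int (pCons c p)) ?x =
    of_int (q ^ Suc k * c - m)" .
  have "(q ^ Suc k * c - m) - q ^ Suc k * poly (pCons c p) b =
        - (m - q ^ k * poly p b) - (q * b + 1) * (q ^ k * poly p b)"
    by (simp add: algebra_simps)
  moreover have "(q * b + 1) dvd \<dots>"
    using dvd by (intro dvd_diff) (simp_all only: dvd_minus_iff dvd_triv_left)
  ultimately show ?case using 1 by metis
qed

lemma root_imp_dvd_poly:
  fixes p :: "int poly" and q b :: int
  assumes "q \<noteq> 0" and root: "poly (map_poly of_int p) (- 1 / of_int q :: rat) = 0"
  shows "(q * b + 1) dvd poly p b"
proof -
  obtain k m where km: "of_int (q ^ k) * poly (map_poly of_int p) (- 1 / of_int q :: rat) = of_int m"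
    and dvd: "(q * b + 1) dvd (m - q ^ k * poly p b)"
    using poly_neg_inverse_cong[OF assms(1)] by blast
  from km root have "m = 0" by simp
  with dvd have "(q * b + 1) dvd q ^ k * poly p b" by simp
  moreover have "coprime (q * b + 1) q"
    by (rule coprimeI) (metis dvd_add_right_iff dvd_mult2)
  then have "coprime (q * b + 1) (q ^ k)" by simp
  ultimately show ?thesis by (simp add: coprime_dvd_mult_right_iff)
qed

lemma poly_stern_poly_2: "poly (stern_poly n) 2 = int n"
proof (induction n rule: less_induct)
  case (less n)
  consider "n = 0" | "n = 1" | m where "n = 2 * m" "m > 0" | m where "n = Suc (2 * m)" "m > 0"
    by (metis One_nat_def Suc_eq_plus1 evenE gr0I mult_0_right oddE)
  then show ?case
    by cases (simp_all add: less stern_poly_0 stern_poly_1 stern_poly_double stern_poly_double_Suc)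
qed

lemma even_poly_stern_poly_1_iff: "even (poly (stern_poly n) 1) \<longleftrightarrow> 3 dvd n"
proof (induction n rule: less_induct)
  case (less n)
  consider "n = 0" | "n = 1" | m where "n = 2 * m" "m > 0" | m where "n = Suc (2 * m)" "m > 0"
    by (metis One_nat_def Suc_eq_plus1 evenE gr0I mult_0_right oddE)
  then show ?case
  proof cases
    case (3 m)
    then have "even (poly (stern_poly n) 1) \<longleftrightarrow> 3 dvd m"
      by (simp add: stern_poly_double less)
    also have "\<dots> \<longleftrightarrow> 3 dvd n" unfolding 3 by presburger
    finally show ?thesis .
  next
    case (4 m)
    then have "even (poly (stern_poly n) 1) \<longleftrightarrow> (3 dvd m \<longleftrightarrow> 3 dvd Suc m)"
      by (simp add: stern_poly_double_Suc less)
    also have "\<dots> \<longleftrightarrow> 3 dvd n" unfolding 4 by presburger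
    finally show ?thesis .
  qed (simp_all add: stern_poly_0 stern_poly_1)
qed

lemma stern_root_neg_half_dvd:
  assumes "stern_value (- 1 / 2) n = 0"
  shows "5 dvd n"
proof -
  have "5 dvd poly (stern_poly n) 2"
    using root_imp_dvd_poly[of 2 "stern_poly n" 2] assms by (simp add: stern_value_def)
  then show ?thesis by (simp add: poly_stern_poly_2) presburger
qed

lemma stern_root_neg_third_dvd:
  assumes "stern_value (- 1 / 3) n = 0"
  shows "21 dvd n"
proof -
  have "7 dvd poly (stern_poly n) 2"
    using root_imp_dvd_poly[of 3 "stern_poly n" 2] assms by (simp add: stern_value_def)
  then have "7 dvd n" by (simp add: poly_stern_poly_2) presburger
  have "4 dvd poly (stern_poly n) 1"
    using root_imp_dvd_poly[of 3 "stern_poly n" 1] assms by (simp add: stern_value_def)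
  then have "even (poly (stern_poly n) 1)" by presburger
  then have "3 dvd n" by (simp add: even_poly_stern_poly_1_iff)
  with \<open>7 dvd n\<close> show ?thesis by presburger
qed

section \<open>Translation of zeros\<close>

text \<open>
  The recurrence is linear and sends the pair of values at \<open>(m, m + 1)\<close> to the values on the block
  from \<open>2^k m\<close> to \<open>2^k (m + 1)\<close>. The coefficients are found at \<open>m = 0\<close>, where the pair is \<open>(0, 1)\<close>,
  and by the symmetry of the recurrence under reversal of a block.
\<close>

lemma stern_value_block:
  assumes "r \<le> 2 ^ k"
  shows "stern_value a (2 ^ k * m + r) =
         stern_value a (2 ^ k - r) * stern_value a m + stern_value a r * stern_value a (Suc m)"
  using assms
proof (induction k arbitrary: r)
  case 0
  then have "r = 0 \<or> r = 1" by auto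
  then show ?case by (auto simp: stern_value_0 stern_value_1)
next
  case (Suc k)
  show ?case
  proof (cases "even r")
    case True
    then obtain s where r: "r = 2 * s" by blast
    with Suc.prems have s: "s \<le> 2 ^ k" by simp
    have "2 ^ Suc k * m + r = 2 * (2 ^ k * m + s)" "2 ^ Suc k - r = 2 * (2 ^ k - s)"
      by (simp_all add: r diff_mult_distrib2)
    then show ?thesis
      by (simp only: r stern_value_double Suc.IH[OF s]) (simp add: algebra_simps)
  next
    case False
    then obtain s where r: "r = Suc (2 * s)" by (auto elim: oddE)
    with Suc.prems have s: "Suc s \<le> 2 ^ k" by simp
    have *: "2 ^ Suc k * m + r = Suc (2 * (2 ^ k * m + s))"
      "2 ^ Suc k - r = Suc (2 * (2 ^ k - Suc s))" "Suc (2 ^ k - Suc s) = 2 ^ k - s"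
      using s by (simp_all add: r)
    have "stern_value a (2 ^ Suc k * m + r) =
          stern_value a (2 ^ k * m + s) + stern_value a (2 ^ k * m + Suc s)"
      by (simp only: * stern_value_double_Suc add_Suc_right)
    also have "\<dots> = (stern_value a (2 ^ k - Suc s) + stern_value a (2 ^ k - s)) * stern_value a m +
                    (stern_value a s + stern_value a (Suc s)) * stern_value a (Suc m)"
      using Suc.IH[of s] Suc.IH[of "Suc s"] s by (simp add: algebra_simps)
    also have "stern_value a (2 ^ k - Suc s) + stern_value a (2 ^ k - s) =
               stern_value a (2 ^ Suc k - r)"
      by (simp only: * stern_value_double_Suc)
    also have "stern_value a s + stern_value a (Suc s) = stern_value a r"
      by (simp only: r stern_value_double_Suc)
    finally show ?thesis .
  qed
qed

lemma stern_value_zero_translate: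
  assumes "stern_value a c = 0" "stern_value a n = 0" "n \<le> 2 ^ k"
  shows "stern_value a (2 ^ k * c + n) = 0" "stern_value a (2 ^ k * c - n) = 0"
proof -
  show "stern_value a (2 ^ k * c + n) = 0"
    using stern_value_block[OF assms(3), of a c] assms by simp
  show "stern_value a (2 ^ k * c - n) = 0"
  proof (cases c)
    case 0
    then show ?thesis by (simp add: stern_value_0)
  next
    case (Suc d)
    with assms(3) have "2 ^ k * c - n = 2 ^ k * d + (2 ^ k - n)" by simp
    then show ?thesis
      using stern_value_block[of "2 ^ k - n" k a d] assms Suc by simp
  qed
qed

lemma stern_value_5: "stern_value a 5 = 2 * a + 1"
  using stern_value_double[of a 1] stern_value_double_Suc[of a 1] stern_value_double_Suc[of a 2]
  by (simp add: stern_value_1 numeral_eq_Suc)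

lemma stern_value_21: "stern_value a 21 = (3 * a + 1) * (a + 1)"
  using stern_value_double[of a 1] stern_value_double_Suc[of a 1]
    stern_value_double[of a 3] stern_value_double[of a 5] stern_value_5[of a]
    stern_value_double_Suc[of a 5] stern_value_double_Suc[of a 10]
  by (simp add: stern_value_1 numeral_eq_Suc algebra_simps)

theorem theorem2p2:
  shows "((*) 2 ` stern_roots (-1/2) \<subseteq> stern_roots (-1/2) \<and>
          (*) 2 ` stern_roots (-1/3) \<subseteq> stern_roots (-1/3)) \<and>
         (stern_roots (-1/2) \<subseteq> (*) 5 ` (UNIV :: nat set) \<and>
          stern_roots (-1/3) \<subseteq> (*) 21 ` (UNIV :: nat set)) \<and>
         (\<forall>n k :: nat. 5 * n \<in> stern_roots (-1/2) \<and> 2 ^ k > 5 * n \<longrightarrow>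
            5 * (2 ^ k + n) \<in> stern_roots (-1/2) \<and> 5 * (2 ^ k - n) \<in> stern_roots (-1/2)) \<and>
         (\<forall>n k :: nat. 21 * n \<in> stern_roots (-1/3) \<and> 2 ^ k > 21 * n \<longrightarrow>
            21 * (2 ^ k + n) \<in> stern_roots (-1/3) \<and> 21 * (2 ^ k - n) \<in> stern_roots (-1/3))"
proof -
  have double: "(*) 2 ` stern_roots a \<subseteq> stern_roots a" for a
    by (auto simp: mem_stern_roots_iff stern_value_double)
  have translate: "c * (2 ^ k + n) \<in> stern_roots a \<and> c * (2 ^ k - n) \<in> stern_roots a"
    if "stern_value a c = 0" "c * n \<in> stern_roots a \<and> 2 ^ k > c * n" for a c n k
    using stern_value_zero_translate[of a c "c * n" k] that
    by (simp add: mem_stern_roots_iff distrib_left diff_mult_distrib2 mult.commute[of c "2 ^ k"])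
  have "stern_roots (-1/2) \<subseteq> (*) 5 ` UNIV"
    using stern_root_neg_half_dvd by (blast elim: dvdE dest: mem_stern_roots_iff[THEN iffD1])
  moreover have "stern_roots (-1/3) \<subseteq> (*) 21 ` UNIV"
    using stern_root_neg_third_dvd by (blast elim: dvdE dest: mem_stern_roots_iff[THEN iffD1])
  moreover have "stern_value (-1/2) 5 = 0" "stern_value (-1/3) 21 = 0"
    by (simp_all add: stern_value_5 stern_value_21)
  ultimately show ?thesis
    using double translate by blast
qed

end
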